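(* Let $1<q\leq\infty$, let $p$ be defined by $p^{-1}+q^{-1}=1$ (so $1\le p<\infty$), let $d\geq1$ be an integer, and set $\varphi(z)=z_1+z_2+\cdots+z_d$ for $z\in\mathbb{T}^\infty$. Then \[\psi(z)=\frac{d}{\|\varphi\|_{L^p(\mathbb{T}^\infty)}^p}\,|\varphi(z)|^{p-2}\varphi(z)\] is the unique element of $L^q(\mathbb{T}^\infty)$ of minimal norm such that $P\psi=\varphi$.
   Context: $\mathbb{T}^\infty$ is the countably infinite cartesian product of $\mathbb{T}=\{z\in\mathbb{C} : |z|=1\}$, equipped with its Haar measure $\mu_\infty$ (the infinite product of the normalized Lebesgue arc measure on $\mathbb{T}$), and $L^q(\mathbb{T}^\infty)$ is taken with respect to $\mu_\infty$. Let $\mathbb{Z}_0^\infty$ (resp. $\mathbb{N}_0^\infty$) be the set of sequences of integers (resp. non-negative integers) with only finitely many non-zero components, and write $z^\alpha=\prod_j z_j^{\alpha_j}$. Every $f\in L^1(\mathbb{T}^\infty)$ has a Fourier series $f(z)=\sum_{\alpha\in\mathbb{Z}_0^\infty} c_\alpha z^\alpha$ with $c_\alpha=\int_{\mathbb{T}^\infty} f(z)\overline{z^\alpha}\,d\mu_\infty(z)$. The Riesz projection is $Pf(z)=\sum_{\alpha\in\mathbb{N}_0^\infty} c_\alpha z^\alpha$; the condition $P\psi=\varphi$ means that the Fourier coefficients of $\psi$ and $\varphi$ agree for every index $\alpha\in\mathbb{N}_0^\infty$. The expression $|\varphi|^{p-2}\varphi$ is defined almost everywhere (where $\varphi\neq0$).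 *)

theory Defs
  imports "HOL-Probability.Probability"
begin

text \<open>
  The circle \<open>sphere 0 1\<close> with its normalized arc measure. The infinite torus is
  \<open>space torus_measure\<close>; its coordinates, written $z_1, z_2, \dots$ informally, are
  numbered from \<open>0\<close> here.
\<close>

definition circle_measure :: "complex measure" where
  "circle_measure =
     distr (uniform_measure lborel {0..2 * pi}) (restrict_space borel (sphere 0 1)) cis"

definition torus_measure :: "(nat \<Rightarrow> complex) measure" where
  "torus_measure = (\<Pi>\<^sub>M j\<in>UNIV. circle_measure)"

lemma cis_measurable_circle:
  "cis \<in> uniform_measure lborel {0..2 * pi} \<rightarrow>\<^sub>M restrict_space borel (sphere 0 1)"
proof (rule measurable_restrict_space2)
  have "cis \<in> borel_measurable borel"
    by (intro borel_measurable_continuous_onI continuous_intros)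
  then show "cis \<in> borel_measurable (uniform_measure lborel {0..2 * pi})"
    by (simp cong: measurable_cong_sets)
qed auto

lemma prob_space_circle_measure: "prob_space circle_measure"
  unfolding circle_measure_def
  by (intro prob_space.prob_space_distr prob_space_uniform_measure cis_measurable_circle) auto

lemma space_torus_measure: "space torus_measure = {z. \<forall>j. norm (z j) = 1}"
  by (auto simp: torus_measure_def circle_measure_def space_PiM space_restrict_space)

lemma prob_space_torus_measure: "prob_space torus_measure"
  unfolding torus_measure_def by (intro prob_space_PiM prob_space_circle_measure)

text \<open>
  Elements of $L^q$ are represented by measurable functions, to be identified when they agree
  almost everywhere. \<open>Lq_norm\<close> is meaningful only on \<open>Lq_space\<close>.
\<close>

definition Lq_space :: "ennreal \<Rightarrow> 'a measure \<Rightarrow> ('a \<Rightarrow> complex) set" where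
  "Lq_space q M = {f \<in> borel_measurable M.
     if q = \<infinity> then esssup M (\<lambda>x. ennreal (norm (f x))) < \<infinity>
     else integrable M (\<lambda>x. norm (f x) powr enn2real q)}"

definition Lq_norm :: "ennreal \<Rightarrow> 'a measure \<Rightarrow> ('a \<Rightarrow> complex) \<Rightarrow> real" where
  "Lq_norm q M f =
     (if q = \<infinity> then enn2real (esssup M (\<lambda>x. ennreal (norm (f x))))
      else (\<integral>x. norm (f x) powr enn2real q \<partial>M) powr (1 / enn2real q))"

definition int_indices :: "(nat \<Rightarrow> int) set" where
  "int_indices = {\<alpha>. finite {j. \<alpha> j \<noteq> 0}}"

definition nonneg_indices :: "(nat \<Rightarrow> int) set" where
  "nonneg_indices = {\<alpha> \<in> int_indices. \<forall>j. 0 \<le> \<alpha> j}"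

definition torus_monomial :: "(nat \<Rightarrow> int) \<Rightarrow> (nat \<Rightarrow> complex) \<Rightarrow> complex" where
  "torus_monomial \<alpha> z = (\<Prod>j\<in>{j. \<alpha> j \<noteq> 0}. z j powi \<alpha> j)"

definition fourier_coeff :: "((nat \<Rightarrow> complex) \<Rightarrow> complex) \<Rightarrow> (nat \<Rightarrow> int) \<Rightarrow> complex" where
  "fourier_coeff f \<alpha> = (\<integral>z. f z * cnj (torus_monomial \<alpha> z) \<partial>torus_measure)"

text \<open>The condition $P\psi = \varphi$, where $P$ is the Riesz projection.\<close>

definition Riesz_projects_to ::
    "((nat \<Rightarrow> complex) \<Rightarrow> complex) \<Rightarrow> ((nat \<Rightarrow> complex) \<Rightarrow> complex) \<Rightarrow> bool" where
  "Riesz_projects_to \<psi> \<phi> \<longleftrightarrow>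
     (\<forall>\<alpha>\<in>nonneg_indices. fourier_coeff \<psi> \<alpha> = fourier_coeff \<phi> \<alpha>)"

definition minimal_norm_preimage ::
    "ennreal \<Rightarrow> ((nat \<Rightarrow> complex) \<Rightarrow> complex) \<Rightarrow> ((nat \<Rightarrow> complex) \<Rightarrow> complex) \<Rightarrow> bool" where
  "minimal_norm_preimage q \<phi> \<psi> \<longleftrightarrow>
     \<psi> \<in> Lq_space q torus_measure \<and> Riesz_projects_to \<psi> \<phi> \<and>
     (\<forall>f\<in>Lq_space q torus_measure. Riesz_projects_to f \<phi> \<longrightarrow>
        Lq_norm q torus_measure \<psi> \<le> Lq_norm q torus_measure f)"

end

theory Submission
  imports Defs
begin

text \<open>
  The weight \<open>norm (\<phi> z) powr (p - 2)\<close> is invariant under simultaneous rotation and under permutation of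
  \<open>z\<^sub>1, \<dots>, z\<^sub>d\<close>. Simultaneous rotation makes \<open>\<psi>\<close> homogeneous of degree one, so among the nonnegative
  indices only those of single coordinates carry Fourier coefficients; permutation makes the first
  \<open>d\<close> of these equal, and pairing \<open>\<psi>\<close> with \<open>\<phi>\<close> shows that they are \<open>1\<close>.

  Every competitor \<open>f\<close> has the same pairing \<open>d\<close> with \<open>\<phi>\<close>. For finite \<open>q\<close>, integrate the tangent line
  inequality of the strictly convex function \<open>\<lambda>w. norm w powr q\<close> at \<open>\<psi> z\<close>: its gradient there is a
  constant multiple of \<open>\<phi> z\<close>, so the linear term integrates to zero. For infinite \<open>q\<close>, use
  \<open>Re (f z * cnj (\<phi> z)) \<le> Lq_norm \<infinity> torus_measure f * norm (\<phi> z)\<close>; uniqueness here needs that \<open>\<phi>\<close>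
  vanishes only on a null set.
\<close>

section \<open>Rotation invariance of the arc measure on the circle\<close>

text \<open>Half-open windows can be cut and reassembled without overlap, which closed ones
  cannot.\<close>

lemma emeasure_lborel_Icc_Int_eq_Ico:
  fixes a b :: real
  assumes [measurable]: "B \<in> sets borel"
  shows "emeasure lborel ({a..b} \<inter> B) = emeasure lborel ({a..<b} \<inter> B)"
proof (rule emeasure_eq_AE)
  show "AE x in lborel. x \<in> {a..b} \<inter> B \<longleftrightarrow> x \<in> {a..<b} \<inter> B"
    using AE_lborel_singleton[of b] by eventually_elim auto
qed auto

lemma emeasure_lborel_vimage_plus:
  fixes c :: real
  assumes "B \<in> sets borel"
  shows "emeasure lborel ((+) c -` B) = emeasure lborel B"
proof -
  have "emeasure lborel B = emeasure (distr lborel borel ((+) c)) B"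
    by (simp add: lborel_distr_plus)
  also have "\<dots> = emeasure lborel ((+) c -` B)"
    using assms by (subst emeasure_distr) auto
  finally show ?thesis ..
qed

text \<open>Translation carries the window \<open>{0..<s}\<close> to \<open>{t..<s + t}\<close>. The
  piece above \<open>s\<close> is moved down by one period onto \<open>{0..<t}\<close>, which fills
  the gap below \<open>t\<close>.\<close>

lemma emeasure_lborel_periodic_shift:
  fixes s t :: real
  assumes B[measurable]: "B \<in> sets borel" and per: "\<And>x. x + s \<in> B \<longleftrightarrow> x \<in> B"
    and t: "0 \<le> t" "t \<le> s"
  shows "emeasure lborel ({0..s} \<inter> (+) t -` B) = emeasure lborel ({0..s} \<inter> B)"
proof -
  have m: "(+) t -` B \<in> sets borel"
    using measurable_sets[of "(+) t" borel borel B] by simp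
  have "emeasure lborel ({0..s} \<inter> (+) t -` B) = emeasure lborel ({0..<s} \<inter> (+) t -` B)"
    by (rule emeasure_lborel_Icc_Int_eq_Ico[OF m])
  also have "{0..<s} \<inter> (+) t -` B = (+) t -` ({t..<s + t} \<inter> B)"
    by auto
  also have "emeasure lborel \<dots> = emeasure lborel ({t..<s + t} \<inter> B)"
    by (rule emeasure_lborel_vimage_plus) auto
  also have "{t..<s + t} \<inter> B = ({t..<s} \<inter> B) \<union> ({s..<s + t} \<inter> B)"
    using t by auto
  also have "emeasure lborel \<dots> = emeasure lborel ({t..<s} \<inter> B) + emeasure lborel ({s..<s + t} \<inter> B)"
    by (rule plus_emeasure[symmetric]) auto
  also have "emeasure lborel ({s..<s + t} \<inter> B) = emeasure lborel ((+) s -` ({s..<s + t} \<inter> B))"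
    by (rule emeasure_lborel_vimage_plus[symmetric]) auto
  also have "(+) s -` ({s..<s + t} \<inter> B) = {0..<t} \<inter> B"
    using per by (simp add: set_eq_iff add.commute[of s])
  also have "emeasure lborel ({t..<s} \<inter> B) + emeasure lborel ({0..<t} \<inter> B)
      = emeasure lborel (({t..<s} \<inter> B) \<union> ({0..<t} \<inter> B))"
    by (rule plus_emeasure) auto
  also have "({t..<s} \<inter> B) \<union> ({0..<t} \<inter> B) = {0..<s} \<inter> B"
    using t by auto
  also have "emeasure lborel \<dots> = emeasure lborel ({0..s} \<inter> B)"
    by (rule emeasure_lborel_Icc_Int_eq_Ico[OF B, symmetric])
  finally show ?thesis .
qed

lemma sets_circle_measure: "sets circle_measure = sets (restrict_space borel (sphere 0 1))"
  by (simp add: circle_measure_def)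

lemma space_circle_measure: "space circle_measure = sphere 0 1"
  by (simp add: circle_measure_def space_restrict_space)

lemma vimage_cis_borel:
  assumes "A \<in> sets circle_measure"
  shows "cis -` A \<in> sets borel"
proof -
  have "cis -` A \<inter> space (uniform_measure lborel {0..2 * pi}) \<in> sets (uniform_measure lborel {0..2 * pi})"
    using assms by (intro measurable_sets[OF cis_measurable_circle]) (simp add: sets_circle_measure)
  then show ?thesis by simp
qed

lemma emeasure_circle_measure:
  assumes "A \<in> sets circle_measure"
  shows "emeasure circle_measure A
    = emeasure lborel ({0..2 * pi} \<inter> cis -` A) / emeasure lborel {0..2 * pi}"
proof -
  have "emeasure circle_measure A = emeasure (uniform_measure lborel {0..2 * pi}) (cis -` A)"
    using assms unfolding circle_measure_def
    by (subst emeasure_distr[OF cis_measurable_circle]) (auto simp: space_restrict_space)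
  also have "\<dots> = emeasure lborel ({0..2 * pi} \<inter> cis -` A) / emeasure lborel {0..2 * pi}"
    using vimage_cis_borel[OF assms] by (intro emeasure_uniform_measure) auto
  finally show ?thesis .
qed

lemma measurable_mult_cis_circle: "(*) (cis t) \<in> circle_measure \<rightarrow>\<^sub>M circle_measure"
proof -
  have "(*) (cis t) \<in> borel_measurable (restrict_space borel (sphere 0 1))"
    by (intro borel_measurable_continuous_on_restrict continuous_intros)
  then have "(*) (cis t) \<in> restrict_space borel (sphere 0 1) \<rightarrow>\<^sub>M restrict_space borel (sphere 0 1)"
    by (intro measurable_restrict_space2) (auto simp: space_restrict_space norm_mult)
  then show ?thesis
    by (simp cong: measurable_cong_sets add: sets_circle_measure)
qed

text \<open>In the angle coordinate the rotation is translation by \<open>t\<close>, and preimages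
  under \<open>cis\<close> have period \<open>2 * pi\<close>. The range of \<open>t\<close> is that
  of the periodic shift; every angle chosen below lies in it.\<close>

lemma distr_circle_rotation:
  assumes t: "0 \<le> t" "t \<le> 2 * pi"
  shows "distr circle_measure circle_measure ((*) (cis t)) = circle_measure"
proof (rule measure_eqI)
  fix A assume "A \<in> sets (distr circle_measure circle_measure ((*) (cis t)))"
  then have A: "A \<in> sets circle_measure" by simp
  define A' where "A' = (*) (cis t) -` A \<inter> space circle_measure"
  have A': "A' \<in> sets circle_measure"
    unfolding A'_def by (rule measurable_sets[OF measurable_mult_cis_circle A])
  have eq: "cis -` A' = (+) t -` (cis -` A)"
    by (auto simp: A'_def cis_mult space_circle_measure)
  have per: "x + 2 * pi \<in> cis -` A \<longleftrightarrow> x \<in> cis -` A" for x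
    by (simp add: cis.code)
  have "emeasure (distr circle_measure circle_measure ((*) (cis t))) A = emeasure circle_measure A'"
    unfolding A'_def by (rule emeasure_distr[OF measurable_mult_cis_circle A])
  also have "\<dots> = emeasure circle_measure A"
    unfolding emeasure_circle_measure[OF A] emeasure_circle_measure[OF A'] eq
    using emeasure_lborel_periodic_shift[OF vimage_cis_borel[OF A] per t] by simp
  finally show "emeasure (distr circle_measure circle_measure ((*) (cis t))) A = emeasure circle_measure A" .
qed simp

section \<open>Invariance of the torus measure under rotations and permutations\<close>

text \<open>Finite cylinders determine the product measure. A componentwise map pulls a cylinder
  back to the cylinder over the preimages of its sides, so invariance of each factor gives equal
  products.\<close>

lemma distr_PiM_componentwise:
  assumes M: "\<And>i. i \<in> I \<Longrightarrow> prob_space (M i)"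
    and f: "\<And>i. i \<in> I \<Longrightarrow> f i \<in> M i \<rightarrow>\<^sub>M M i" "\<And>i. i \<in> I \<Longrightarrow> distr (M i) (M i) (f i) = M i"
  shows "distr (Pi\<^sub>M I M) (Pi\<^sub>M I M) (\<lambda>x. \<lambda>i\<in>I. f i (x i)) = Pi\<^sub>M I M"
proof (rule measure_eqI_PiM_infinite[symmetric, OF refl])
  interpret prob_space "Pi\<^sub>M I M"
    using M by (rule prob_space_PiM)
  show "finite_measure (Pi\<^sub>M I M)" by unfold_locales
  have meas: "(\<lambda>x. \<lambda>i\<in>I. f i (x i)) \<in> Pi\<^sub>M I M \<rightarrow>\<^sub>M Pi\<^sub>M I M"
    using f(1) by (intro measurable_restrict measurable_compose[OF measurable_component_singleton]) auto
  fix A J assume J: "finite J" "J \<subseteq> I" and A: "\<And>i. i \<in> J \<Longrightarrow> A i \<in> sets (M i)"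
  have "Pi\<^sub>M I M (prod_emb I M J (Pi\<^sub>E J A)) = (\<Prod>i\<in>J. M i (A i))"
    using J A by (intro emeasure_PiM_emb M) auto
  also have "\<dots> = (\<Prod>i\<in>J. M i (f i -` A i \<inter> space (M i)))"
  proof (rule prod.cong[OF refl])
    fix i assume i: "i \<in> J"
    have "M i (A i) = distr (M i) (M i) (f i) (A i)" using f(2) i J by auto
    also have "\<dots> = M i (f i -` A i \<inter> space (M i))"
      using f(1) i J A by (intro emeasure_distr) auto
    finally show "M i (A i) = M i (f i -` A i \<inter> space (M i))" .
  qed
  also have "\<dots> = Pi\<^sub>M I M (prod_emb I M J (\<Pi>\<^sub>E i\<in>J. f i -` A i \<inter> space (M i)))"
    using f(1) J A by (intro emeasure_PiM_emb[symmetric] M measurable_sets[of "f _"]) auto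
  also have "prod_emb I M J (\<Pi>\<^sub>E i\<in>J. f i -` A i \<inter> space (M i))
      = (\<lambda>x. \<lambda>i\<in>I. f i (x i)) -` prod_emb I M J (Pi\<^sub>E J A) \<inter> space (Pi\<^sub>M I M)"
  proof -
    have "f i (x i) \<in> space (M i)" if "x \<in> (\<Pi>\<^sub>E i\<in>I. space (M i))" "i \<in> I" for x i
      using that by (intro measurable_space[OF f(1)]) auto
    moreover have "i \<in> I" if "i \<in> J" for i using that J by auto
    ultimately show ?thesis
      by (fastforce simp: prod_emb_def space_PiM PiE_iff simp del: restrict_apply intro: extensional_restrict
        restrict_extensional simp: restrict_apply')
  qed
  also have "Pi\<^sub>M I M \<dots> = distr (Pi\<^sub>M I M) (Pi\<^sub>M I M) (\<lambda>x. \<lambda>i\<in>I. f i (x i)) (prod_emb I M J (Pi\<^sub>E J A))"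
    using J A by (intro emeasure_distr[symmetric] meas sets_PiM_I) auto
  finally show "Pi\<^sub>M I M (prod_emb I M J (Pi\<^sub>E J A)) =
    distr (Pi\<^sub>M I M) (Pi\<^sub>M I M) (\<lambda>x. \<lambda>i\<in>I. f i (x i)) (prod_emb I M J (Pi\<^sub>E J A))" .
qed simp

definition torus_rotation :: "(nat \<Rightarrow> real) \<Rightarrow> (nat \<Rightarrow> complex) \<Rightarrow> nat \<Rightarrow> complex" where
  "torus_rotation \<theta> z = (\<lambda>j. cis (\<theta> j) * z j)"

lemma measurable_torus_rotation[measurable]: "torus_rotation \<theta> \<in> torus_measure \<rightarrow>\<^sub>M torus_measure"
  unfolding torus_rotation_def torus_measure_def
proof (intro measurable_PiM_single')
  fix j
  show "(\<lambda>z. cis (\<theta> j) * z j) \<in> (\<Pi>\<^sub>M j\<in>UNIV. circle_measure) \<rightarrow>\<^sub>M circle_measure"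
    by (rule measurable_compose[OF _ measurable_mult_cis_circle]) simp
qed (auto simp: space_PiM space_circle_measure norm_mult)

lemma distr_torus_rotation:
  assumes "\<And>j. 0 \<le> \<theta> j" "\<And>j. \<theta> j \<le> 2 * pi"
  shows "distr torus_measure torus_measure (torus_rotation \<theta>) = torus_measure"
  using distr_PiM_componentwise[of UNIV "\<lambda>_. circle_measure" "\<lambda>j. (*) (cis (\<theta> j))"] assms
  by (simp add: torus_measure_def torus_rotation_def[abs_def] restrict_UNIV prob_space_circle_measure
      measurable_mult_cis_circle distr_circle_rotation)

lemma distr_torus_permute:
  fixes \<pi> :: "nat \<Rightarrow> nat"
  assumes "inj \<pi>"
  shows "distr torus_measure torus_measure (\<lambda>z. z \<circ> \<pi>) = torus_measure"
  using distr_PiM_reindex[of UNIV "\<lambda>_. circle_measure" \<pi> UNIV] assms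
  by (simp add: torus_measure_def prob_space_circle_measure comp_def restrict_UNIV)

lemma measurable_permute[measurable]: "(\<lambda>z. z \<circ> \<pi>) \<in> torus_measure \<rightarrow>\<^sub>M torus_measure"
  unfolding torus_measure_def comp_def
  by (intro measurable_PiM_single') (auto simp: space_PiM)

lemma measurable_torus_component[measurable]: "(\<lambda>z. z j) \<in> borel_measurable torus_measure"
proof -
  have "(\<lambda>z. z j) \<in> torus_measure \<rightarrow>\<^sub>M restrict_space borel (sphere 0 1)"
    unfolding torus_measure_def
    by (subst measurable_cong_sets[OF refl sets_circle_measure[symmetric]]) (rule measurable_component_singleton, simp)
  then show ?thesis by (simp add: measurable_restrict_space2_iff)
qed

lemma measurable_torus_monomial[measurable]: "torus_monomial \<alpha> \<in> borel_measurable torus_measure"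
  unfolding torus_monomial_def[abs_def] power_int_def by measurable

lemma borel_measurable_cnj[measurable (raw)]:
  "f \<in> borel_measurable M \<Longrightarrow> (\<lambda>x. cnj (f x)) \<in> borel_measurable M"
  by (rule borel_measurable_continuous_on[OF continuous_on_cnj[OF continuous_on_id]])

section \<open>Fourier coefficients of functions with symmetries\<close>

lemma integral_torus_rotation:
  fixes F :: "(nat \<Rightarrow> complex) \<Rightarrow> complex"
  assumes "\<And>j. 0 \<le> \<theta> j" "\<And>j. \<theta> j \<le> 2 * pi" "F \<in> borel_measurable torus_measure"
  shows "(\<integral>z. F (torus_rotation \<theta> z) \<partial>torus_measure) = (\<integral>z. F z \<partial>torus_measure)"
  using integral_distr[OF measurable_torus_rotation[of \<theta>] assms(3)] distr_torus_rotation[of \<theta>] assms(1,2)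
  by simp

lemma torus_monomial_rotation:
  "torus_monomial \<alpha> (torus_rotation \<theta> z) = cis (\<Sum>j\<in>{j. \<alpha> j \<noteq> 0}. of_int (\<alpha> j) * \<theta> j) * torus_monomial \<alpha> z"
proof -
  \<comment> \<open>For infinite \<open>A\<close> both sides are \<open>1\<close>, by the default
    values of sum and product.\<close>
  have *: "cis (\<Sum>j\<in>A. of_int (\<alpha> j) * \<theta> j) = (\<Prod>j\<in>A. cis (of_int (\<alpha> j) * \<theta> j))" for A
    by (induction A rule: infinite_finite_induct) (auto simp: cis_mult[symmetric])
  show ?thesis
    by (simp add: torus_monomial_def torus_rotation_def power_int_mult_distrib prod.distrib cis_power_int *)
qed

text \<open>The rotation preserves the integral but multiplies the integrand by the constant in
  \<open>ne\<close>. A number that is fixed by a factor other than \<open>1\<close> is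
  \<open>0\<close>.\<close>

lemma fourier_coeff_eq_0_rotation:
  assumes \<theta>: "\<And>j. 0 \<le> \<theta> j" "\<And>j. \<theta> j \<le> 2 * pi"
    and F[measurable]: "F \<in> borel_measurable torus_measure"
    and rot: "\<And>z. F (torus_rotation \<theta> z) = cis a * F z"
    and ne: "cis (a - (\<Sum>j\<in>{j. \<alpha> j \<noteq> 0}. of_int (\<alpha> j) * \<theta> j)) \<noteq> 1"
  shows "fourier_coeff F \<alpha> = 0"
proof -
  let ?s = "\<Sum>j\<in>{j. \<alpha> j \<noteq> 0}. of_int (\<alpha> j) * \<theta> j"
  have "fourier_coeff F \<alpha> = (\<integral>z. F (torus_rotation \<theta> z) * cnj (torus_monomial \<alpha> (torus_rotation \<theta> z)) \<partial>torus_measure)"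
    unfolding fourier_coeff_def by (rule integral_torus_rotation[OF \<theta>, symmetric]) measurable
  also have "\<dots> = (\<integral>z. cis (a - ?s) * (F z * cnj (torus_monomial \<alpha> z)) \<partial>torus_measure)"
    by (intro Bochner_Integration.integral_cong refl)
       (simp add: rot torus_monomial_rotation cis_cnj flip: cis_divide cis_inverse, simp add: divide_inverse)
  also have "\<dots> = cis (a - ?s) * fourier_coeff F \<alpha>"
    by (simp add: fourier_coeff_def)
  finally show ?thesis using ne by (auto simp: mult_cancel_right1)
qed

definition unit_index :: "nat \<Rightarrow> nat \<Rightarrow> int" where
  "unit_index k = (\<lambda>j. if j = k then 1 else 0)"

abbreviation coord_sum :: "nat \<Rightarrow> (nat \<Rightarrow> complex) \<Rightarrow> complex" where
  "coord_sum d z \<equiv> (\<Sum>j<d. z j)"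

lemma unit_index_nonneg: "unit_index k \<in> nonneg_indices"
  by (auto simp: unit_index_def nonneg_indices_def int_indices_def)

lemma torus_monomial_unit_index: "torus_monomial (unit_index k) z = z k"
  by (simp add: torus_monomial_def unit_index_def)

text \<open>Each entry on the support is at least \<open>1\<close>, so total degree one leaves room
  for a single support point. Nonnegativity is essential here: \<open>z 0 * z 1 / z 2\<close> has
  degree one as well.\<close>

lemma nonneg_index_sum_1:
  assumes \<alpha>: "\<alpha> \<in> nonneg_indices" and sum: "(\<Sum>j\<in>{j. \<alpha> j \<noteq> 0}. \<alpha> j) = 1"
  obtains k where "\<alpha> = unit_index k"
proof -
  let ?S = "{j. \<alpha> j \<noteq> 0}"
  have fin: "finite ?S" and ge: "\<And>j. 0 \<le> \<alpha> j"
    using \<alpha> by (auto simp: nonneg_indices_def int_indices_def)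
  have "?S \<noteq> {}" using sum by force
  then obtain k where k: "\<alpha> k \<noteq> 0" by blast
  have pos: "1 \<le> \<alpha> j" if "j \<in> ?S" for j using ge[of j] that by auto
  have split: "1 = \<alpha> k + (\<Sum>j\<in>?S - {k}. \<alpha> j)"
    using sum fin k by (simp add: sum.remove[of ?S k])
  have "int (card (?S - {k})) = (\<Sum>j\<in>?S - {k}. 1)" by simp
  also have "\<dots> \<le> (\<Sum>j\<in>?S - {k}. \<alpha> j)" using pos by (intro sum_mono) blast
  finally have "card (?S - {k}) = 0" "\<alpha> k = 1" using split pos[of k] k by auto
  moreover from this(1) fin have "?S - {k} = {}" by (simp only: card_0_eq finite_Diff)
  ultimately have "\<alpha> = unit_index k" by (auto simp: unit_index_def fun_eq_iff)
  then show ?thesis by (rule that)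
qed

text \<open>Under a common rotation by \<open>t\<close> a monomial picks up \<open>cis t\<close> to
  the power of its total degree, so only degree one is compatible with \<open>hom\<close>.\<close>

lemma fourier_coeff_homogeneous_eq_0:
  assumes F: "F \<in> borel_measurable torus_measure"
    and hom: "\<And>t z. F (torus_rotation (\<lambda>_. t) z) = cis t * F z"
    and sum: "(\<Sum>j\<in>{j. \<alpha> j \<noteq> 0}. \<alpha> j) \<noteq> 1"
  shows "fourier_coeff F \<alpha> = 0"
proof -
  define n where "n = 1 - (\<Sum>j\<in>{j. \<alpha> j \<noteq> 0}. \<alpha> j)"
  \<comment> \<open>The integrand is multiplied by \<open>cis (of_int n * t)\<close>; this angle
    makes the argument \<open>pi\<close> or \<open>- pi\<close>, so the factor is
    \<open>- 1\<close>.\<close>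
  define t where "t = pi / \<bar>of_int n\<bar>"
  have n: "n \<noteq> 0" "1 \<le> \<bar>n\<bar>" using sum by (auto simp: n_def)
  then have n': "1 \<le> \<bar>real_of_int n\<bar>" by linarith
  have t: "0 \<le> t" "t \<le> 2 * pi"
  proof -
    show "0 \<le> t" by (simp add: t_def)
    have "t \<le> pi / 1" unfolding t_def using n' by (intro divide_left_mono) auto
    then show "t \<le> 2 * pi" using pi_ge_zero by linarith
  qed
  have "t - (\<Sum>j\<in>{j. \<alpha> j \<noteq> 0}. of_int (\<alpha> j) * t) = of_int n * t"
    by (simp add: n_def sum_distrib_right left_diff_distrib)
  also have "\<dots> = (if n > 0 then pi else - pi)"
    using n by (simp add: t_def)
  finally have "cis (t - (\<Sum>j\<in>{j. \<alpha> j \<noteq> 0}. of_int (\<alpha> j) * t)) = - 1"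
    by (simp add: cis.ctr complex_eq_iff)
  with t hom F show ?thesis
    by (intro fourier_coeff_eq_0_rotation[of "\<lambda>_. t" F t]) auto
qed

text \<open>A half turn of the coordinate \<open>k\<close> alone fixes \<open>F\<close> and changes
  the sign of the monomial.\<close>

lemma fourier_coeff_unit_index_eq_0:
  assumes F: "F \<in> borel_measurable torus_measure"
    and inv: "\<And>z. F (torus_rotation (\<lambda>j. if j = k then pi else 0) z) = F z"
  shows "fourier_coeff F (unit_index k) = 0"
  using F inv
  by (intro fourier_coeff_eq_0_rotation[of "\<lambda>j. if j = k then pi else 0" F 0])
     (auto simp: unit_index_def cis.ctr complex_eq_iff)

text \<open>Substituting the transposition preserves the measure and turns the monomial
  \<open>z k\<close> into \<open>z l\<close>.\<close>

lemma fourier_coeff_permute: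
  assumes [measurable]: "F \<in> borel_measurable torus_measure"
    and inv: "\<And>z. F (z \<circ> Transposition.transpose k l) = F z"
  shows "fourier_coeff F (unit_index k) = fourier_coeff F (unit_index l)"
proof -
  let ?\<pi> = "Transposition.transpose k l"
  let ?G = "\<lambda>z. F z * cnj (torus_monomial (unit_index k) z)"
  have "integral\<^sup>L torus_measure ?G = integral\<^sup>L (distr torus_measure torus_measure (\<lambda>z. z \<circ> ?\<pi>)) ?G"
    by (simp add: distr_torus_permute)
  also have "\<dots> = (\<integral>z. ?G (z \<circ> ?\<pi>) \<partial>torus_measure)"
    by (rule integral_distr) measurable
  also have "\<dots> = fourier_coeff F (unit_index l)"
    by (simp add: fourier_coeff_def inv torus_monomial_unit_index)
  finally show ?thesis by (simp add: fourier_coeff_def)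
qed

section \<open>The coordinate sum, its Riesz preimages and its zero set\<close>

lemma coord_sum_rotate: "coord_sum d (torus_rotation (\<lambda>_. t) z) = cis t * coord_sum d z"
  by (simp add: torus_rotation_def sum_distrib_left)

lemma coord_sum_rotate_other:
  assumes "d \<le> k"
  shows "coord_sum d (torus_rotation (\<lambda>j. if j = k then t else 0) z) = coord_sum d z"
  using assms by (intro sum.cong) (auto simp: torus_rotation_def)

lemma coord_sum_permute:
  assumes "k < d" "l < d"
  shows "coord_sum d (z \<circ> Transposition.transpose k l) = coord_sum d z"
proof -
  have "bij_betw (Transposition.transpose k l) {..<d} {..<d}"
    using assms by (intro bij_betw_byWitness[where f' = "Transposition.transpose k l"])
      (auto simp: Transposition.transpose_def)
  then show ?thesis by (simp add: sum.reindex_bij_betw comp_def)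
qed

lemma norm_coord_sum_le:
  assumes "z \<in> space torus_measure"
  shows "norm (coord_sum d z) \<le> d"
  using sum_norm_le[of "{..<d}" z "\<lambda>_. 1"] assms by (simp add: space_torus_measure)

text \<open>Orthonormality of the coordinate functions: the mixed terms vanish by a half turn of the
  coordinate \<open>k\<close>, and the remaining term integrates \<open>1\<close>.\<close>

lemma fourier_coeff_coord_sum:
  assumes "k < d"
  shows "fourier_coeff (coord_sum d) (unit_index k) = 1"
proof -
  interpret prob_space torus_measure by (rule prob_space_torus_measure)
  have int: "integrable torus_measure (\<lambda>z. z j * cnj (z k))" for j
    by (rule integrable_const_bound[of _ 1]) (auto simp: space_torus_measure norm_mult)
  have "(\<integral>z. z j * cnj (z k) \<partial>torus_measure) = (if j = k then 1 else 0)" for j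
  proof (cases "j = k")
    case True
    have "(\<integral>z. z k * cnj (z k) \<partial>torus_measure) = (\<integral>z. 1 \<partial>torus_measure)"
      by (intro Bochner_Integration.integral_cong) (auto simp: space_torus_measure simp flip: complex_norm_square)
    then show ?thesis using True by (simp add: prob_space)
  next
    case False
    then have "fourier_coeff (\<lambda>z. z j) (unit_index k) = 0"
      by (intro fourier_coeff_unit_index_eq_0) (auto simp: torus_rotation_def)
    with False show ?thesis by (simp add: fourier_coeff_def torus_monomial_unit_index)
  qed
  then show ?thesis
    using assms int by (simp add: fourier_coeff_def torus_monomial_unit_index sum_distrib_right)
qed

text \<open>Homogeneity leaves only the unit indices. Those with \<open>k \<ge> d\<close> vanish
  because \<open>F\<close> ignores \<open>z k\<close>; the others have equal coefficients by
  symmetry, so the total in \<open>one\<close> makes each of them \<open>1\<close>. A sum is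
  required there because pairing with \<open>coord_sum d\<close> produces exactly this sum.\<close>

lemma Riesz_projects_to_coord_sum:
  assumes [measurable]: "w \<in> borel_measurable borel"
    and F: "F = (\<lambda>z. complex_of_real (w (norm (coord_sum d z))) * coord_sum d z)"
    and one: "(\<Sum>k<d. fourier_coeff F (unit_index k)) = d"
  shows "Riesz_projects_to F (coord_sum d)"
  unfolding Riesz_projects_to_def
proof
  fix \<alpha> assume \<alpha>: "\<alpha> \<in> nonneg_indices"
  have F_meas: "F \<in> borel_measurable torus_measure" unfolding F by measurable
  have cs_meas: "coord_sum d \<in> borel_measurable torus_measure" by measurable
  show "fourier_coeff F \<alpha> = fourier_coeff (coord_sum d) \<alpha>"
  proof (cases "(\<Sum>j\<in>{j. \<alpha> j \<noteq> 0}. \<alpha> j) = 1")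
    case False
    then have "fourier_coeff F \<alpha> = 0"
      by (intro fourier_coeff_homogeneous_eq_0 F_meas) (simp_all add: F coord_sum_rotate norm_mult)
    moreover have "fourier_coeff (coord_sum d) \<alpha> = 0"
      using False by (intro fourier_coeff_homogeneous_eq_0 cs_meas) (simp_all add: coord_sum_rotate)
    ultimately show ?thesis by simp
  next
    case True
    then obtain k where k: "\<alpha> = unit_index k" using nonneg_index_sum_1[OF \<alpha>] by blast
    show ?thesis
    proof (cases "k < d")
      case True
      have "fourier_coeff F (unit_index l) = fourier_coeff F (unit_index k)" if "l < d" for l
        using True that by (intro fourier_coeff_permute F_meas) (simp add: F coord_sum_permute del: o_apply)
      then have "(\<Sum>l<d. fourier_coeff F (unit_index l)) = (\<Sum>l<d. fourier_coeff F (unit_index k))"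
        by (intro sum.cong) auto
      also have "\<dots> = of_nat d * fourier_coeff F (unit_index k)" by simp
      finally have "of_nat d * fourier_coeff F (unit_index k) = of_nat d"
        using one True by (metis gr_zeroI less_nat_zero_code of_real_of_nat_eq)
      then show ?thesis using True by (simp add: k fourier_coeff_coord_sum)
    next
      case False
      then have "fourier_coeff F (unit_index k) = 0"
        by (intro fourier_coeff_unit_index_eq_0 F_meas) (simp add: F coord_sum_rotate_other)
      moreover have "fourier_coeff (coord_sum d) (unit_index k) = 0"
        using False by (intro fourier_coeff_unit_index_eq_0 cs_meas) (simp add: coord_sum_rotate_other)
      ultimately show ?thesis by (simp add: k)
    qed
  qed
qed

lemma integrable_mult_cnj_coord_sum:
  assumes "integrable torus_measure f"
  shows "integrable torus_measure (\<lambda>z. f z * cnj (coord_sum d z))"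
proof (rule Bochner_Integration.integrable_bound)
  show "integrable torus_measure (\<lambda>z. of_nat d * norm (f z))" using assms by simp
  show "AE z in torus_measure. norm (f z * cnj (coord_sum d z)) \<le> norm (of_nat d * norm (f z))"
  proof (rule AE_I2)
    fix z assume "z \<in> space torus_measure"
    then show "norm (f z * cnj (coord_sum d z)) \<le> norm (of_nat d * norm (f z))"
      using mult_left_mono[OF norm_coord_sum_le, of z "norm (f z)" d] by (simp add: norm_mult mult.commute del: cnj_sum)
  qed
qed (use assms in measurable)

lemma integral_mult_cnj_coord_sum:
  assumes "integrable torus_measure f"
  shows "(\<integral>z. f z * cnj (coord_sum d z) \<partial>torus_measure) = (\<Sum>k<d. fourier_coeff f (unit_index k))"
proof -
  have "integrable torus_measure (\<lambda>z. f z * cnj (z k))" for k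
    by (rule Bochner_Integration.integrable_bound[OF assms])
       (use assms in \<open>auto simp: norm_mult space_torus_measure\<close>)
  then show ?thesis
    by (simp add: fourier_coeff_def torus_monomial_unit_index sum_distrib_left)
qed

text \<open>The pairing sees only unit indices, which are nonnegative and hence prescribed by the
  Riesz condition. This is the linear constraint behind both optimality arguments.\<close>

lemma integral_mult_cnj_coord_sum_Riesz:
  assumes "integrable torus_measure f" "Riesz_projects_to f (coord_sum d)"
  shows "(\<integral>z. f z * cnj (coord_sum d z) \<partial>torus_measure) = d"
  using assms
  by (simp add: integral_mult_cnj_coord_sum Riesz_projects_to_def unit_index_nonneg fourier_coeff_coord_sum
      del: cnj_sum)

text \<open>Rotating \<open>z 0\<close> by infinitely many different angles yields pairwise disjoint copies of the zero
  set, all of the same measure.\<close>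

lemma AE_coord_sum_nonzero:
  assumes "d > 0"
  shows "AE z in torus_measure. coord_sum d z \<noteq> 0"
proof -
  interpret prob_space torus_measure by (rule prob_space_torus_measure)
  define r where "r n = torus_rotation (\<lambda>j. if j = 0 then inverse (real (Suc n)) else 0)" for n
  define Z where "Z = {z \<in> space torus_measure. coord_sum d z = 0}"
  define D where "D n = r n -` Z \<inter> space torus_measure" for n
  have Z: "Z \<in> sets torus_measure" unfolding Z_def by measurable
  have D: "D n \<in> sets torus_measure" for n
    unfolding D_def r_def by (intro measurable_sets[OF measurable_torus_rotation Z])
  have le: "inverse (real (Suc n)) \<le> 1" for n
    by (simp add: field_simps)
  have le_pi: "inverse (real (Suc n)) \<le> 2 * pi" for n
    using le[of n] pi_gt3 by linarith
  have measure_D: "measure torus_measure (D n) = measure torus_measure Z" for n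
  proof -
    have "measure torus_measure Z = measure (distr torus_measure torus_measure (r n)) Z"
      unfolding r_def using le_pi by (subst distr_torus_rotation) auto
    also have "\<dots> = measure torus_measure (D n)"
      unfolding D_def r_def by (rule measure_distr[OF measurable_torus_rotation Z])
    finally show ?thesis ..
  qed
  have "disjoint_family D"
    unfolding disjoint_family_on_def
  proof safe
    fix m n z assume mn: "m \<noteq> n" and z: "z \<in> D m" "z \<in> D n"
    have split: "{..<d} = insert 0 {1..<d}" using assms by auto
    have eq: "coord_sum d (r i z) = cis (inverse (real (Suc i))) * z 0 + (\<Sum>j\<in>{1..<d}. z j)" for i
      unfolding split r_def torus_rotation_def by (subst sum.insert) auto
    have "coord_sum d (r m z) = 0" "coord_sum d (r n z) = 0"
      using z by (auto simp: D_def Z_def)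
    \<comment> \<open>Only the first summand depends on the rotation, so the common rest of the two
      sums cancels.\<close>
    then have "cis (inverse (real (Suc m))) * z 0 = cis (inverse (real (Suc n))) * z 0"
      unfolding eq by (metis add_right_cancel)
    moreover have "norm (z 0) = 1" using z by (simp add: D_def space_torus_measure)
    then have "z 0 \<noteq> 0" by force
    ultimately have "cis (inverse (real (Suc m))) = cis (inverse (real (Suc n)))" by simp
    \<comment> \<open>The angles lie in \<open>{0..pi}\<close>, where the cosine alone separates
      them.\<close>
    then have "cos (inverse (real (Suc m))) = cos (inverse (real (Suc n)))"
      by (metis cis.sel(1))
    moreover have "inverse (real (Suc i)) \<in> {0..pi}" for i
      using le[of i] pi_gt3 by auto
    ultimately have "inverse (real (Suc m)) = inverse (real (Suc n))"
      by (metis atLeastAtMost_iff cos_inj_pi)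
    with mn show "z \<in> {}" by simp
  qed
  then have "(\<lambda>n. measure torus_measure (D n)) sums measure torus_measure (\<Union>n. D n)"
    using D by (intro finite_measure_UNION) auto
  \<comment> \<open>A series with constant terms converges only if the constant is
    \<open>0\<close>.\<close>
  then have "measure torus_measure Z = 0"
    by (simp add: measure_D sums_iff summable_const_iff)
  then have "emeasure torus_measure Z = 0" by (simp add: emeasure_eq_measure)
  with Z show ?thesis
    by (intro AE_I[of _ _ Z]) (auto simp: Z_def)
qed

section \<open>Strict convexity and the case of a finite exponent\<close>

text \<open>By the mean value theorem the slope of the chord is the derivative at an intermediate
  point, and the derivative is strictly increasing. The case \<open>b = 0\<close> is computed
  directly, since the derivative is available only at positive points.\<close>

lemma powr_above_tangent:
  fixes a b r :: real
  assumes r: "1 < r" and a: "0 < a" and b: "0 \<le> b" "b \<noteq> a"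
  shows "a powr r + r * a powr (r - 1) * (b - a) < b powr r"
proof (cases "b = 0")
  case True
  have "a powr r = a powr (r - 1) * a"
    using a by (simp add: powr_diff)
  with True r a show ?thesis by (simp add: algebra_simps)
next
  case False
  with b have b0: "0 < b" by simp
  have der: "((\<lambda>x. x powr r) has_real_derivative r * x powr (r - 1)) (at x)" if "x > 0" for x
    using that by (rule has_real_derivative_powr)
  show ?thesis
  proof (cases "a < b")
    case True
    then obtain x where x: "a < x" "x < b" "b powr r - a powr r = (b - a) * (r * x powr (r - 1))"
      using MVT2[of a b "\<lambda>x. x powr r" "\<lambda>x. r * x powr (r - 1)"] der a by force
    have "a powr (r - 1) < x powr (r - 1)"
      using x a r by (intro powr_less_mono2) auto
    then have "(b - a) * (r * a powr (r - 1)) < (b - a) * (r * x powr (r - 1))"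
      using True r by simp
    with x(3) show ?thesis by (simp add: algebra_simps)
  next
    case False
    with b have "b < a" by simp
    then obtain x where x: "b < x" "x < a" "a powr r - b powr r = (a - b) * (r * x powr (r - 1))"
      using MVT2[of b a "\<lambda>x. x powr r" "\<lambda>x. r * x powr (r - 1)"] der b0 by force
    have "x powr (r - 1) < a powr (r - 1)"
      using x b0 r by (intro powr_less_mono2) auto
    then have "(a - b) * (r * x powr (r - 1)) < (a - b) * (r * a powr (r - 1))"
      using \<open>b < a\<close> r by simp
    with x(3) show ?thesis by (simp add: algebra_simps)
  qed
qed

text \<open>The term with factor \<open>r\<close> is the derivative of \<open>norm _ powr r\<close>
  at \<open>v\<close> in direction \<open>w - v\<close>. If the norms differ,
  \<open>Re (w * cnj v) \<le> norm w * norm v\<close> reduces the claim to the real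
  inequality.\<close>

lemma norm_powr_above_tangent:
  fixes v w :: complex
  assumes r: "1 < r" and ne: "w \<noteq> v"
  shows "norm v powr r + r * (norm v powr (r - 2) * Re ((w - v) * cnj v)) < norm w powr r"
proof (cases "v = 0")
  case True
  with ne r show ?thesis by simp
next
  case False
  define a where "a = norm v"
  have a: "0 < a" using False by (simp add: a_def)
  have "Re (v * cnj v) = a\<^sup>2" by (simp add: a_def complex_mult_cnj cmod_power2)
  then have Re: "Re ((w - v) * cnj v) = Re (w * cnj v) - a\<^sup>2"
    by (simp add: left_diff_distrib)
  have le: "Re (w * cnj v) \<le> norm w * a"
    using complex_Re_le_cmod[of "w * cnj v"] by (simp add: norm_mult a_def)
  have pw: "a powr (r - 2) * (a * x) = a powr (r - 1) * x" for x
  proof -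
    have "a powr (r - 1) = a powr (r - 2) * a powr 1" 
      using a powr_add[of a "r - 2" 1] by simp
    then show ?thesis using a by simp
  qed
  have pos: "0 < a powr (r - 2)" using a by simp
  have upper: "a powr (r - 2) * (norm w * a - a\<^sup>2) = a powr (r - 1) * (norm w - a)"
    using pw[of "norm w - a"] by (simp add: algebra_simps power2_eq_square)
  show ?thesis
  proof (cases "norm w = a")
    case True
    \<comment> \<open>For equal norms the real inequality is no longer strict; strictness comes from
      the angle between \<open>w\<close> and \<open>v\<close>.\<close>
    have "0 < (norm (w - v))\<^sup>2" using ne by simp
    also have "\<dots> = (norm w)\<^sup>2 + a\<^sup>2 - 2 * Re (w * cnj v)"
      by (simp only: a_def cmod_power2) (simp add: power2_eq_square algebra_simps)
    finally have "Re (w * cnj v) - a\<^sup>2 < 0" using True by simp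
    then have "r * (a powr (r - 2) * Re ((w - v) * cnj v)) < 0"
      unfolding Re using r by (intro mult_pos_neg pos) auto
    then show ?thesis using True by (simp add: a_def)
  next
    case False
    have "a powr (r - 2) * Re ((w - v) * cnj v) \<le> a powr (r - 1) * (norm w - a)"
      unfolding upper[symmetric] Re using le pos by (intro mult_left_mono) auto
    then have "r * (a powr (r - 2) * Re ((w - v) * cnj v)) \<le> r * a powr (r - 1) * (norm w - a)"
      using r by simp
    moreover have "a powr r + r * a powr (r - 1) * (norm w - a) < norm w powr r"
      using powr_above_tangent[OF r a, of "norm w"] False by simp
    ultimately show ?thesis unfolding a_def by linarith
  qed
qed

text \<open>Here \<open>r\<close> is the exponent of the norm to be minimized and \<open>s\<close>
  its conjugate: \<open>(s - 1) * (r - 1) = 1\<close> is the relation between reciprocals cleared of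
  denominators. The integrals are compared before taking roots.\<close>

lemma minimal_preimage_finite_exponent:
  fixes C r s :: real
  assumes r: "1 < r" and C: "0 < C" and s: "(s - 1) * (r - 1) = 1"
    and \<psi>: "\<psi> = (\<lambda>z. complex_of_real (C * norm (coord_sum d z) powr (s - 2)) * coord_sum d z)"
    and \<psi>_L: "integrable torus_measure (\<lambda>z. norm (\<psi> z) powr r)" "integrable torus_measure \<psi>"
    and \<psi>_P: "Riesz_projects_to \<psi> (coord_sum d)"
    and f: "f \<in> borel_measurable torus_measure" "integrable torus_measure (\<lambda>z. norm (f z) powr r)"
    and f_P: "Riesz_projects_to f (coord_sum d)"
  shows "(\<integral>z. norm (\<psi> z) powr r \<partial>torus_measure) \<le> (\<integral>z. norm (f z) powr r \<partial>torus_measure)"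
    and "(\<integral>z. norm (f z) powr r \<partial>torus_measure) \<le> (\<integral>z. norm (\<psi> z) powr r \<partial>torus_measure)
      \<Longrightarrow> AE z in torus_measure. f z = \<psi> z"
proof -
  interpret prob_space torus_measure by (rule prob_space_torus_measure)
  note [measurable] = f(1)
  have f_int: "integrable torus_measure f"
  proof (rule Bochner_Integration.integrable_bound)
    show "integrable torus_measure (\<lambda>z. 1 + norm (f z) powr r)" using f(2) by simp
    \<comment> \<open>This majorant is integrable because the measure is finite.\<close>
    have "x \<le> 1 + x powr r" if "0 \<le> x" for x :: real
    proof (cases "x \<le> 1")
      case False
      then have "x powr 1 \<le> x powr r" using r by (intro powr_mono) auto
      with False show ?thesis by simp
    qed (simp add: add_increasing2)
    then show "AE z in torus_measure. norm (f z) \<le> norm (1 + norm (f z) powr r)" by simp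
  qed (rule f(1))
  \<comment> \<open>The form of \<open>\<psi>\<close> is chosen for this identity: the powers of
    \<open>norm (coord_sum d z)\<close> collect to the exponent
    \<open>(s - 1) * (r - 1) - 1 = 0\<close>, so the gradient at \<open>\<psi> z\<close> is a
    constant multiple of the coordinate sum.\<close>
  have conj: "complex_of_real (norm (\<psi> z) powr (r - 2)) * cnj (\<psi> z)
      = complex_of_real (C powr (r - 1)) * cnj (coord_sum d z)" for z
  proof (cases "coord_sum d z = 0")
    case True
    then show ?thesis by (simp add: \<psi> del: cnj_sum)
  next
    case False
    define x where "x = norm (coord_sum d z)"
    have x: "0 < x" using False by (simp add: x_def)
    have "norm (\<psi> z) = C * x powr (s - 2) * x powr 1"
      using C x by (simp add: \<psi> norm_mult x_def)
    also have "\<dots> = C * x powr (s - 1)"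
      by (simp only: mult.assoc flip: powr_add) simp
    finally have "norm (\<psi> z) powr (r - 2) * (C * x powr (s - 2))
        = (C powr (r - 2) * C powr 1) * (x powr ((s - 1) * (r - 2)) * x powr (s - 2))"
      using C by (simp add: powr_mult powr_powr mult_ac)
    also have "\<dots> = C powr (r - 1) * x powr ((s - 1) * (r - 2) + (s - 2))"
      by (simp only: flip: powr_add) simp
    also have "(s - 1) * (r - 2) + (s - 2) = (s - 1) * (r - 1) - 1"
      by (simp add: algebra_simps)
    also have "C powr (r - 1) * x powr \<dots> = C powr (r - 1)"
      using s x by simp
    finally have *: "norm (\<psi> z) powr (r - 2) * (C * x powr (s - 2)) = C powr (r - 1)" .
    have "complex_of_real (norm (\<psi> z) powr (r - 2)) * cnj (\<psi> z)
        = complex_of_real (norm (\<psi> z) powr (r - 2) * (C * x powr (s - 2))) * cnj (coord_sum d z)"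
      by (simp add: \<psi> x_def mult.assoc del: cnj_sum)
    then show ?thesis unfolding * .
  qed
  \<comment> \<open>In this form the linear term integrates to \<open>0\<close>, since
    \<open>f\<close> and \<open>\<psi>\<close> have the same pairing with
    \<open>coord_sum d\<close>. By \<open>gap_eq\<close> the value is also the height above the
    tangent at \<open>\<psi> z\<close>, which gives its sign.\<close>
  define gap where "gap z = norm (f z) powr r - norm (\<psi> z) powr r
    - r * C powr (r - 1) * Re ((f z - \<psi> z) * cnj (coord_sum d z))" for z
  have gap_eq: "gap z = norm (f z) powr r
      - (norm (\<psi> z) powr r + r * (norm (\<psi> z) powr (r - 2) * Re ((f z - \<psi> z) * cnj (\<psi> z))))" for z
  proof -
    have "norm (\<psi> z) powr (r - 2) * Re ((f z - \<psi> z) * cnj (\<psi> z))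
        = Re ((f z - \<psi> z) * (complex_of_real (norm (\<psi> z) powr (r - 2)) * cnj (\<psi> z)))"
      by (simp add: algebra_simps)
    also have "\<dots> = C powr (r - 1) * Re ((f z - \<psi> z) * cnj (coord_sum d z))"
      unfolding conj by (simp add: algebra_simps del: cnj_sum)
    finally show ?thesis by (simp add: gap_def del: cnj_sum)
  qed
  have gap_pos: "0 < gap z" if "f z \<noteq> \<psi> z" for z
    using norm_powr_above_tangent[OF r that] by (simp add: gap_eq)
  have gap_nonneg: "0 \<le> gap z" for z
    using gap_pos[of z] by (cases "f z = \<psi> z") (simp_all add: gap_eq)
  have int_diff: "integrable torus_measure (\<lambda>z. (f z - \<psi> z) * cnj (coord_sum d z))"
    using f_int \<psi>_L(2) by (intro integrable_mult_cnj_coord_sum) simp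
  have gap_int: "integrable torus_measure gap"
    unfolding gap_def using f(2) \<psi>_L(1) int_diff by (intro Bochner_Integration.integrable_diff integrable_mult_right integrable_Re)
  have "(\<integral>z. (f z - \<psi> z) * cnj (coord_sum d z) \<partial>torus_measure) = 0"
    using integral_mult_cnj_coord_sum_Riesz[OF f_int f_P] integral_mult_cnj_coord_sum_Riesz[OF \<psi>_L(2) \<psi>_P]
      integrable_mult_cnj_coord_sum[OF f_int, of d] integrable_mult_cnj_coord_sum[OF \<psi>_L(2), of d]
    by (simp add: left_diff_distrib del: cnj_sum)
  then have "(\<integral>z. Re ((f z - \<psi> z) * cnj (coord_sum d z)) \<partial>torus_measure) = 0"
    by (simp only: integral_Re[OF int_diff]) simp
  then have gap_integral: "integral\<^sup>L torus_measure gap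
      = (\<integral>z. norm (f z) powr r \<partial>torus_measure) - (\<integral>z. norm (\<psi> z) powr r \<partial>torus_measure)"
    unfolding gap_def using f(2) \<psi>_L(1) integrable_Re[OF int_diff]
    by (simp only: Bochner_Integration.integral_diff Bochner_Integration.integrable_diff
        integrable_mult_right integral_mult_right_zero)
  have nonneg: "0 \<le> integral\<^sup>L torus_measure gap"
    using gap_nonneg by simp
  with gap_integral show "(\<integral>z. norm (\<psi> z) powr r \<partial>torus_measure) \<le> (\<integral>z. norm (f z) powr r \<partial>torus_measure)"
    by simp
  assume "(\<integral>z. norm (f z) powr r \<partial>torus_measure) \<le> (\<integral>z. norm (\<psi> z) powr r \<partial>torus_measure)"
  with gap_integral nonneg have "integral\<^sup>L torus_measure gap = 0" by simp
  then have "AE z in torus_measure. gap z = 0"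
    using integral_nonneg_eq_0_iff_AE[OF gap_int] gap_nonneg by simp
  then show "AE z in torus_measure. f z = \<psi> z"
    by eventually_elim (use gap_pos in force)
qed

section \<open>The case of an infinite exponent\<close>

text \<open>Hoelder's inequality for the exponents \<open>\<infinity>\<close> and \<open>1\<close>,
  with its equality case, applied to the fixed pairing \<open>d\<close>.\<close>

lemma bounded_Riesz_preimage:
  fixes B :: real
  assumes f: "f \<in> borel_measurable torus_measure" "AE z in torus_measure. norm (f z) \<le> B"
    and f_P: "Riesz_projects_to f (coord_sum d)"
  shows "real d \<le> B * (\<integral>z. norm (coord_sum d z) \<partial>torus_measure)"
    and "real d = B * (\<integral>z. norm (coord_sum d z) \<partial>torus_measure) \<Longrightarrow>
      AE z in torus_measure. Re (f z * cnj (coord_sum d z)) = B * norm (coord_sum d z)"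
proof -
  interpret prob_space torus_measure by (rule prob_space_torus_measure)
  have f_int: "integrable torus_measure f"
    using f by (intro integrable_const_bound[of _ B])
  have \<phi>_int: "integrable torus_measure (\<lambda>z. norm (coord_sum d z))"
    using norm_coord_sum_le by (intro integrable_const_bound[of _ "real d"]) auto
  note prod_int = integrable_mult_cnj_coord_sum[OF f_int, of d]
  define gap where "gap z = B * norm (coord_sum d z) - Re (f z * cnj (coord_sum d z))" for z
  have gap_nonneg: "AE z in torus_measure. 0 \<le> gap z"
    using f(2)
  proof eventually_elim
    case (elim z)
    have "Re (f z * cnj (coord_sum d z)) \<le> norm (f z) * norm (coord_sum d z)"
      using complex_Re_le_cmod[of "f z * cnj (coord_sum d z)"] by (simp add: norm_mult del: cnj_sum)
    also have "\<dots> \<le> B * norm (coord_sum d z)"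
      using elim by (intro mult_right_mono) auto
    finally show ?case by (simp add: gap_def del: cnj_sum)
  qed
  have gap_int: "integrable torus_measure gap"
    unfolding gap_def using \<phi>_int prod_int
    by (intro Bochner_Integration.integrable_diff integrable_mult_right integrable_Re)
  have "(\<integral>z. Re (f z * cnj (coord_sum d z)) \<partial>torus_measure) = d"
    using integral_mult_cnj_coord_sum_Riesz[OF f_int f_P] by (simp only: integral_Re[OF prod_int]) simp
  then have gap_integral: "integral\<^sup>L torus_measure gap = B * (\<integral>z. norm (coord_sum d z) \<partial>torus_measure) - d"
    unfolding gap_def using \<phi>_int integrable_Re[OF prod_int]
    by (simp only: Bochner_Integration.integral_diff integrable_mult_right integral_mult_right_zero)
  have "0 \<le> integral\<^sup>L torus_measure gap" by (rule integral_nonneg_AE[OF gap_nonneg])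
  with gap_integral show "real d \<le> B * (\<integral>z. norm (coord_sum d z) \<partial>torus_measure)" by simp
  assume "real d = B * (\<integral>z. norm (coord_sum d z) \<partial>torus_measure)"
  then have "AE z in torus_measure. gap z = 0"
    using integral_nonneg_eq_0_iff_AE[OF gap_int gap_nonneg] gap_integral by simp
  then show "AE z in torus_measure. Re (f z * cnj (coord_sum d z)) = B * norm (coord_sum d z)"
    by eventually_elim (simp add: gap_def del: cnj_sum)
qed

text \<open>With \<open>e\<close> the unit vector in the direction of \<open>v\<close>, expanding
  the square of \<open>norm (u - B * e)\<close> gives at most
  \<open>B\<^sup>2 - 2 * B\<^sup>2 + B\<^sup>2 = 0\<close>.\<close>

lemma eq_scaled_sgn_if_Re_mult_cnj:
  fixes u v :: complex
  assumes le: "norm u \<le> B" and v: "v \<noteq> 0" and eq: "Re (u * cnj v) = B * norm v"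
  shows "u = complex_of_real (B * inverse (norm v)) * v"
proof -
  define e where "e = complex_of_real (inverse (norm v)) * v"
  have e: "norm e = 1" using v by (simp add: e_def norm_mult norm_inverse)
  have Re_e: "Re (u * cnj e) = B"
  proof -
    have "u * cnj e = complex_of_real (inverse (norm v)) * (u * cnj v)"
      by (simp add: e_def)
    moreover have "Re (complex_of_real c * x) = c * Re x" for c x by simp
    ultimately have "Re (u * cnj e) = inverse (norm v) * Re (u * cnj v)" by metis
    with eq v show ?thesis by simp
  qed
  have B: "0 \<le> B" using le norm_ge_zero order_trans by blast
  have "(norm (u - complex_of_real B * e))\<^sup>2 = (norm u)\<^sup>2 - 2 * B * Re (u * cnj e) + B\<^sup>2 * (norm e)\<^sup>2"
    by (simp only: cmod_power2) (simp add: power2_eq_square algebra_simps)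
  also have "\<dots> = (norm u)\<^sup>2 - B\<^sup>2"
    unfolding Re_e e by (simp add: power2_eq_square)
  also have "\<dots> \<le> 0" using power_mono[OF le, of 2] by simp
  finally have "u = complex_of_real B * e" by simp
  then show ?thesis by (simp add: e_def mult.assoc)
qed

section \<open>Conjugate exponents and the conclusion\<close>

lemma conjugate_exponents_cases:
  fixes q :: ennreal and p :: real
  assumes "1 < q" "inverse (ennreal p) + inverse q = 1"
  obtains (infinite) "q = \<infinity>" "p = 1"
  | (finite) r where "q = ennreal r" "1 < r" "1 < p" "(p - 1) * (r - 1) = 1"
proof -
  have p: "0 < p"
  proof (rule ccontr)
    assume "\<not> 0 < p"
    \<comment> \<open>\<open>ennreal\<close> sends negative reals to \<open>0\<close>, whose inverse
      is infinite, so the reciprocals cannot add up to \<open>1\<close>.\<close>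
    then have "ennreal p = 0" by (simp add: ennreal_neg)
    with assms(2) show False by simp
  qed
  show ?thesis
  proof (cases q)
    case top
    then have "ennreal (inverse p) = 1" using assms(2) p by (simp add: inverse_ennreal)
    then have "p = 1" by simp
    with top show ?thesis using infinite by simp
  next
    case (real r)
    then have r: "1 < r" using assms(1) ennreal_less_iff[of 1 r] by simp
    have "ennreal (inverse p + inverse r) = 1"
      using assms(2) p r real by (simp add: inverse_ennreal)
    then have eq: "inverse p + inverse r = 1"
      by simp
    have "inverse r < 1" "0 < inverse r" using r by (auto simp: inverse_less_1_iff)
    with eq have "inverse p < 1" by linarith
    then have "1 < p" using p by (simp add: inverse_less_1_iff)
    moreover have "(p - 1) * (r - 1) = 1" using eq p r by (simp add: field_simps)
    ultimately show ?thesis using finite real r by blast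
  qed
qed

theorem mainTheorem5:
  fixes q :: ennreal and p :: real and d :: nat
    and \<phi> \<psi> :: "(nat \<Rightarrow> complex) \<Rightarrow> complex"
  assumes "1 < q"
    and "inverse (ennreal p) + inverse q = 1"
    and "d \<ge> 1"
    and "\<phi> = (\<lambda>z. \<Sum>j<d. z j)"
    and "\<psi> = (\<lambda>z. complex_of_real
           (real d / Lq_norm (ennreal p) torus_measure \<phi> powr p * norm (\<phi> z) powr (p - 2)) * \<phi> z)"
  shows "minimal_norm_preimage q \<phi> \<psi> \<and>
    (\<forall>f. minimal_norm_preimage q \<phi> f \<longrightarrow> (AE z in torus_measure. f z = \<psi> z))"
proof -
  interpret prob_space torus_measure by (rule prob_space_torus_measure)
  have p: "1 \<le> p" using conjugate_exponents_cases[OF assms(1,2)] by (cases; simp)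
  have d: "0 < d" using assms(3) by simp
  define A where "A = (\<integral>z. norm (coord_sum d z) powr p \<partial>torus_measure)"
  define C where "C = real d / A"
  have int_p: "integrable torus_measure (\<lambda>z. norm (coord_sum d z) powr p)"
    using p norm_coord_sum_le
    by (intro integrable_const_bound[of _ "real d powr p"]) (auto intro!: powr_mono2)
  \<comment> \<open>This ensures \<open>C * A = d\<close>; for \<open>A = 0\<close> the quotient
    \<open>d / A\<close> would be \<open>0\<close> by default.\<close>
  have "A \<noteq> 0"
  proof
    assume "A = 0"
    then have "AE z in torus_measure. norm (coord_sum d z) powr p = 0"
      unfolding A_def using integral_nonneg_eq_0_iff_AE[OF int_p] by simp
    with AE_coord_sum_nonzero[OF d] have "AE z in torus_measure. False"
      by eventually_elim simp
    then show False by simp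
  qed
  moreover have "0 \<le> A" unfolding A_def by simp
  ultimately have A: "0 < A" by simp
  have C: "0 < C" using A d by (simp add: C_def)
  have "Lq_norm (ennreal p) torus_measure \<phi> powr p = A"
    using p A by (simp add: Lq_norm_def assms(4) powr_powr flip: A_def)
  then have \<psi>: "\<psi> = (\<lambda>z. complex_of_real (C * norm (coord_sum d z) powr (p - 2)) * coord_sum d z)"
    by (simp add: assms(4,5) C_def)
  have \<psi>_meas[measurable]: "\<psi> \<in> borel_measurable torus_measure"
    unfolding \<psi> by measurable
  \<comment> \<open>The weight alone can be unbounded near the zeros of \<open>\<phi>\<close> when
    \<open>p < 2\<close>; together with the factor \<open>\<phi>\<close> the exponent becomes
    \<open>p - 1\<close>, which is nonnegative, so \<open>\<psi>\<close> is bounded.\<close>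
  have norm_\<psi>: "norm (\<psi> z) \<le> C * norm (coord_sum d z) powr (p - 1)" for z
  proof (cases "coord_sum d z = 0")
    case True
    then show ?thesis using C by (simp add: \<psi>)
  next
    case False
    define x where "x = norm (coord_sum d z)"
    have "norm (\<psi> z) = C * (x powr (p - 2) * x powr 1)"
      using C False by (simp add: \<psi> norm_mult x_def)
    then show ?thesis unfolding powr_add[symmetric] by (simp add: x_def)
  qed
  define K where "K = C * real d powr (p - 1)"
  have \<psi>_bound: "norm (\<psi> z) \<le> K" if "z \<in> space torus_measure" for z
  proof -
    have "norm (coord_sum d z) powr (p - 1) \<le> real d powr (p - 1)"
      using p norm_coord_sum_le[OF that] by (intro powr_mono2) auto
    then show ?thesis
      using norm_\<psi>[of z] C mult_left_mono unfolding K_def by (meson less_imp_le order_trans)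
  qed
  have \<psi>_int: "integrable torus_measure \<psi>"
    using \<psi>_bound by (intro integrable_const_bound[of _ K]) auto
  have \<psi>_P: "Riesz_projects_to \<psi> (coord_sum d)"
  proof (rule Riesz_projects_to_coord_sum)
    show "\<psi> = (\<lambda>z. complex_of_real ((\<lambda>x. C * x powr (p - 2)) (norm (coord_sum d z))) * coord_sum d z)"
      by (simp add: \<psi>)
    \<comment> \<open>Pointwise pairing gives \<open>C\<close> times the integrand of
      \<open>A\<close>, so the integral is \<open>C * A = d\<close>, the normalization that the
      Riesz condition asks for.\<close>
    have "\<psi> z * cnj (coord_sum d z) = complex_of_real (C * norm (coord_sum d z) powr p)" for z
    proof (cases "coord_sum d z = 0")
      case False
      define x where "x = norm (coord_sum d z)"
      have x: "0 < x" using False by (simp add: x_def)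
      have "\<psi> z * cnj (coord_sum d z) = complex_of_real (C * x powr (p - 2)) * (coord_sum d z * cnj (coord_sum d z))"
        by (simp add: \<psi> x_def del: cnj_sum)
      also have "\<dots> = complex_of_real (C * (x powr (p - 2) * x\<^sup>2))"
        unfolding complex_norm_square[symmetric] x_def by simp
      also have "x powr (p - 2) * x\<^sup>2 = x powr p"
        using x by (simp add: powr_diff)
      finally show ?thesis by (simp add: x_def)
    qed (simp add: \<psi> del: cnj_sum)
    then have "(\<integral>z. \<psi> z * cnj (coord_sum d z) \<partial>torus_measure) = complex_of_real (C * A)"
      unfolding A_def by (simp del: of_real_mult flip: integral_mult_right_zero)
    with A show "(\<Sum>k<d. fourier_coeff \<psi> (unit_index k)) = d"
      unfolding integral_mult_cnj_coord_sum[OF \<psi>_int, symmetric] by (simp add: C_def)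
  qed simp
  have \<phi>: "\<phi> = coord_sum d" by (simp add: assms(4))
  from assms(1,2) show ?thesis
  proof (cases rule: conjugate_exponents_cases)
    \<comment> \<open>Now \<open>p = 1\<close>, so \<open>\<psi>\<close> is bounded by
      \<open>C\<close>, while every bounded preimage has norm at least
      \<open>d / A = C\<close>.\<close>
    case infinite
    have A1: "A = (\<integral>z. norm (coord_sum d z) \<partial>torus_measure)"
      by (simp add: A_def infinite)
    have CA: "real d = C * (\<integral>z. norm (coord_sum d z) \<partial>torus_measure)"
      using A by (simp add: C_def flip: A1)
    have "esssup torus_measure (\<lambda>z. ennreal (norm (\<psi> z))) \<le> ennreal C"
    proof (rule esssup_I)
      have "K = C" using d by (simp add: K_def infinite)
      then show "AE z in torus_measure. ennreal (norm (\<psi> z)) \<le> ennreal C"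
        using \<psi>_bound C by (auto simp: ennreal_le_iff)
    qed measurable
    then have \<psi>_L: "\<psi> \<in> Lq_space q torus_measure" and \<psi>_norm: "Lq_norm q torus_measure \<psi> \<le> C"
      using C infinite enn2real_mono[of _ "ennreal C"]
      by (auto simp: Lq_space_def Lq_norm_def le_less_trans)
    \<comment> \<open>Membership in \<open>Lq_space\<close> keeps the essential supremum finite;
      \<open>enn2real\<close> would turn an infinite one into \<open>0\<close>.\<close>
    have f_AE: "AE z in torus_measure. norm (f z) \<le> Lq_norm q torus_measure f"
      if "f \<in> Lq_space q torus_measure" for f
      using esssup_AE[of "\<lambda>z. ennreal (norm (f z))" torus_measure]
    proof eventually_elim
      case (elim z)
      with that show ?case
        using infinite enn2real_mono[OF elim] by (simp add: Lq_space_def Lq_norm_def)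
    qed
    have minimal: "C \<le> Lq_norm q torus_measure f"
      if f: "f \<in> Lq_space q torus_measure" "Riesz_projects_to f (coord_sum d)" for f
    proof -
      have "real d \<le> Lq_norm q torus_measure f * A"
        unfolding A1 using f f_AE by (intro bounded_Riesz_preimage(1)) (auto simp: Lq_space_def)
      then show ?thesis using A by (simp add: C_def pos_divide_le_eq)
    qed
    have "minimal_norm_preimage q \<phi> \<psi>"
      unfolding minimal_norm_preimage_def \<phi>
      using \<psi>_L \<psi>_P \<psi>_norm minimal by (meson order_trans)
    moreover have "AE z in torus_measure. f z = \<psi> z" if "minimal_norm_preimage q \<phi> f" for f
    proof -
      have f: "f \<in> Lq_space q torus_measure" "Riesz_projects_to f (coord_sum d)"
        "Lq_norm q torus_measure f \<le> C"
        using that \<psi>_L \<psi>_P \<psi>_norm unfolding minimal_norm_preimage_def \<phi> by (auto intro: order_trans)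
      have bound: "AE z in torus_measure. norm (f z) \<le> C"
        using f_AE[OF f(1)]
        by eventually_elim (use f(3) in simp)
      \<comment> \<open>A minimizer has norm at most \<open>C\<close>, and \<open>d = C * A\<close>
        is the equality case for the bound \<open>C\<close>. It fixes \<open>f z\<close> wherever
        \<open>\<phi>\<close> does not vanish.\<close>
      have "AE z in torus_measure. Re (f z * cnj (coord_sum d z)) = C * norm (coord_sum d z)"
        using f bound CA by (intro bounded_Riesz_preimage(2)) (auto simp: Lq_space_def)
      with bound AE_coord_sum_nonzero[OF d] show ?thesis
      proof eventually_elim
        case (elim z)
        then have "f z = complex_of_real (C * inverse (norm (coord_sum d z))) * coord_sum d z"
          by (intro eq_scaled_sgn_if_Re_mult_cnj)
        with elim(2) show ?case by (simp add: \<psi> infinite powr_minus)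
      qed
    qed
    ultimately show ?thesis by blast
  next
    case (finite r)
    have q: "q \<noteq> \<infinity>" "enn2real q = r" using finite by auto
    have \<psi>_int_r: "integrable torus_measure (\<lambda>z. norm (\<psi> z) powr r)"
      using \<psi>_bound finite
      by (intro integrable_const_bound[of _ "K powr r"]) (auto intro!: powr_mono2)
    then have \<psi>_L: "\<psi> \<in> Lq_space q torus_measure"
      using q by (simp add: Lq_space_def)
    note minimal = minimal_preimage_finite_exponent[OF finite(2) C finite(4) \<psi> \<psi>_int_r \<psi>_int \<psi>_P]
    \<comment> \<open>An equivalence is needed: minimality of \<open>\<psi>\<close> passes from
      integrals to norms, and minimality of a competitor passes back.\<close>
    have norm_le_iff: "Lq_norm q torus_measure g \<le> Lq_norm q torus_measure h \<longleftrightarrow>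
      (\<integral>z. norm (g z) powr r \<partial>torus_measure) \<le> (\<integral>z. norm (h z) powr r \<partial>torus_measure)" for g h
    proof -
      have "x powr (1 / r) \<le> y powr (1 / r) \<longleftrightarrow> x \<le> y" if "0 \<le> x" "0 \<le> y" for x y
        using that finite(2) powr_less_mono2[of "1 / r" y x] powr_mono2[of "1 / r" x y] by force
      then show ?thesis using q by (simp add: Lq_norm_def)
    qed
    have "minimal_norm_preimage q \<phi> \<psi>"
      unfolding minimal_norm_preimage_def \<phi> norm_le_iff
      using \<psi>_L \<psi>_P q minimal(1) by (simp add: Lq_space_def)
    moreover have "AE z in torus_measure. f z = \<psi> z" if "minimal_norm_preimage q \<phi> f" for f
      using that \<psi>_L \<psi>_P q
      unfolding minimal_norm_preimage_def \<phi> norm_le_iff by (intro minimal(2)) (auto simp: Lq_space_def)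
    ultimately show ?thesis by blast
  qed
qed

end
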